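(* Let $(X_i,Y_i)_{i=1}^{n+1}$ be an exchangeable sequence of random variables drawn from a distribution $P_{XY}$. Assume that: (i) the base nonconformity score $S(x,y)$ is a deterministic function of its arguments; (ii) the free energy $F(x)$ is a deterministic function of $x$, defined by $F(x)=-\tau\log\sum_{k=1}^{K}\exp(f_k(x)/\tau)$. For $i=1,\dots,n+1$ define the modulated score $$S'_i = S(X_i,Y_i)\cdot\frac{1}{\beta}\log\left(1+e^{-\beta F(X_i)}\right).$$ Then the sequence of modulated scores $(S'_1,\dots,S'_{n+1})$ is exchangeable.
   Context: Inputs $x$ lie in $\mathbb{R}^D$ and labels $y$ in $\{1,\dots,K\}$. The function $f=(f_1,\dots,f_K):\mathbb{R}^D\to\mathbb{R}^K$ is the logit (pre-softmax) function of a trained classifier, $\tau$ is a (positive) temperature parameter, and $\beta>0$ is a sharpness parameter. A base nonconformity score $S(x,y)$ is a real-valued function measuring how poorly label $y$ fits input $x$. A finite sequence of random variables is exchangeable if its joint distribution is invariant under every permutation of its indices. *)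

theory Defs
  imports "HOL-Probability.Probability" "HOL-Combinatorics.Permutations"
begin

text \<open>Sequences of length \<open>m\<close> are indexed by \<open>1, \<dots>, m\<close>. Measurability of the entries is part of the
  definition, since \<^const>\<open>distr\<close> is only meaningful for measurable maps.\<close>

definition exchangeable :: "'w measure \<Rightarrow> 'a measure \<Rightarrow> nat \<Rightarrow> (nat \<Rightarrow> 'w \<Rightarrow> 'a) \<Rightarrow> bool" where
  "exchangeable M N m Z \<longleftrightarrow>
     (\<forall>i\<in>{1..m}. Z i \<in> measurable M N) \<and>
     (\<forall>\<pi>. \<pi> permutes {1..m} \<longrightarrow>
        distr M (PiM {1..m} (\<lambda>_. N)) (\<lambda>\<omega>. \<lambda>i\<in>{1..m}. Z (\<pi> i) \<omega>) =
        distr M (PiM {1..m} (\<lambda>_. N)) (\<lambda>\<omega>. \<lambda>i\<in>{1..m}. Z i \<omega>))"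

text \<open>The label set \<open>{1, \<dots>, K}\<close> is represented by a finite type \<open>'k\<close> with \<open>K = CARD('k)\<close>, which also
  indexes the logits.\<close>

definition free_energy :: "real \<Rightarrow> (real ^ 'd \<Rightarrow> real ^ 'k::finite) \<Rightarrow> real ^ 'd \<Rightarrow> real" where
  "free_energy \<tau> f x = - \<tau> * ln (\<Sum>k\<in>UNIV. exp (f x $ k / \<tau>))"

definition modulated_score ::
    "real \<Rightarrow> real \<Rightarrow> (real ^ 'd \<Rightarrow> real ^ 'k::finite) \<Rightarrow> (real ^ 'd \<Rightarrow> 'k \<Rightarrow> real) \<Rightarrow> real ^ 'd \<Rightarrow> 'k \<Rightarrow> real" where
  "modulated_score \<tau> \<beta> f S x y = S x y * ((1 / \<beta>) * ln (1 + exp (- \<beta> * free_energy \<tau> f x)))"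

end

theory Submission imports Defs begin

text \<open>Each modulated score is the image of the pair (X_i, Y_i) under one deterministic
  measurable map g, the same for every index. Applying g in each coordinate commutes with permuting
  the coordinates, so the law of the permuted scores is the pushforward, under coordinatewise g, of
  the law of the permuted pairs; the latter does not depend on the permutation.
  \<open>exchangeable_compose\<close> is this argument for arbitrary g, and
  \<open>measurable_modulated_score\<close> shows that the score is such a g.\<close>

lemma exchangeable_compose:
  assumes exch: "exchangeable M N m Z" and g: "g \<in> measurable N L"
  shows "exchangeable M L m (\<lambda>i \<omega>. g (Z i \<omega>))"
  unfolding exchangeable_def
proof (intro conjI ballI allI impI)
  have Z: "Z i \<in> measurable M N" if "i \<in> {1..m}" for i
    using exch that by (simp add: exchangeable_def)
  then show "(\<lambda>\<omega>. g (Z i \<omega>)) \<in> measurable M L" if "i \<in> {1..m}" for i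
    using measurable_compose[OF _ g] that by blast
  let ?N = "PiM {1..m} (\<lambda>_. N)" and ?L = "PiM {1..m} (\<lambda>_. L)"
  let ?G = "\<lambda>z. \<lambda>i\<in>{1..m}. g (z i)"
  have G: "?G \<in> measurable ?N ?L"
    by (intro measurable_restrict measurable_compose[OF _ g] measurable_component_singleton)
  \<comment> \<open>Stated for any self-map of the index set, so that it serves both the permutation
    and the identity.\<close>
  have push: "distr M ?L (\<lambda>\<omega>. \<lambda>i\<in>{1..m}. g (Z (\<pi> i) \<omega>)) =
      distr (distr M ?N (\<lambda>\<omega>. \<lambda>i\<in>{1..m}. Z (\<pi> i) \<omega>)) ?L ?G"
    if \<pi>: "\<And>i. i \<in> {1..m} \<Longrightarrow> \<pi> i \<in> {1..m}" for \<pi>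
  proof -
    have "(\<lambda>\<omega>. \<lambda>i\<in>{1..m}. Z (\<pi> i) \<omega>) \<in> measurable M ?N"
      by (intro measurable_restrict Z \<pi>)
    then show ?thesis
      \<comment> \<open>The congruence rule lets simp use that i lies in the index set, where the
        inner restricted function takes its proper value rather than
        \<open>undefined\<close>.\<close>
      by (subst distr_distr[OF G]) (simp_all add: o_def cong: restrict_cong)
  qed
  fix \<pi> assume \<pi>: "\<pi> permutes {1..m}"
  then have "distr M ?N (\<lambda>\<omega>. \<lambda>i\<in>{1..m}. Z (\<pi> i) \<omega>) = distr M ?N (\<lambda>\<omega>. \<lambda>i\<in>{1..m}. Z i \<omega>)"
    using exch by (simp add: exchangeable_def)
  then show "distr M ?L (\<lambda>\<omega>. \<lambda>i\<in>{1..m}. g (Z (\<pi> i) \<omega>)) = distr M ?L (\<lambda>\<omega>. \<lambda>i\<in>{1..m}. g (Z i \<omega>))"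
    \<comment> \<open>Both sides become pushforwards under \<open>?G\<close> of laws already known
      to be equal.\<close>
    using push[of \<pi>] push[of "\<lambda>i. i"] permutes_in_image[OF \<pi>] by simp
qed

text \<open>The score is built from S and the free energy by products, \<open>exp\<close> and
  \<open>ln\<close>, all Borel. Keeping \<open>free_energy\<close> folded lets its assumed
  measurability be used directly, composed with the first projection.\<close>

lemma measurable_modulated_score:
  assumes F: "free_energy \<tau> f \<in> borel_measurable borel"
    and S: "case_prod S \<in> borel_measurable (borel \<Otimes>\<^sub>M count_space UNIV)"
  shows "(\<lambda>(x, y). modulated_score \<tau> \<beta> f S x y) \<in> borel_measurable (borel \<Otimes>\<^sub>M count_space UNIV)"
proof -
  have [measurable]: "(\<lambda>p. free_energy \<tau> f (fst p)) \<in> borel_measurable (borel \<Otimes>\<^sub>M count_space UNIV)"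
    by (rule measurable_compose[OF measurable_fst F])
  have [measurable]: "(\<lambda>p. S (fst p) (snd p)) \<in> borel_measurable (borel \<Otimes>\<^sub>M count_space UNIV)"
    using S by (simp add: case_prod_beta')
  show ?thesis
    unfolding modulated_score_def case_prod_beta' by measurable
qed

theorem theoremG1:
  fixes M :: "'w measure"
    and P :: "((real ^ 'd::finite) \<times> 'k::finite) measure"
    and X :: "nat \<Rightarrow> 'w \<Rightarrow> real ^ 'd"
    and Y :: "nat \<Rightarrow> 'w \<Rightarrow> 'k"
    and f :: "real ^ 'd \<Rightarrow> real ^ 'k"
    and S :: "real ^ 'd \<Rightarrow> 'k \<Rightarrow> real"
    and \<tau> \<beta> :: real
    and n :: nat
  assumes "prob_space M"
    and "\<tau> > 0" and "\<beta> > 0"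
    and "free_energy \<tau> f \<in> borel_measurable borel"
    and "case_prod S \<in> borel_measurable (borel \<Otimes>\<^sub>M count_space UNIV)"
    and "exchangeable M (borel \<Otimes>\<^sub>M count_space UNIV) (n + 1) (\<lambda>i \<omega>. (X i \<omega>, Y i \<omega>))"
    and "\<And>i. i \<in> {1..n + 1} \<Longrightarrow>
           distr M (borel \<Otimes>\<^sub>M count_space UNIV) (\<lambda>\<omega>. (X i \<omega>, Y i \<omega>)) = P"
  shows "exchangeable M borel (n + 1) (\<lambda>i \<omega>. modulated_score \<tau> \<beta> f S (X i \<omega>) (Y i \<omega>))"
  using exchangeable_compose[OF assms(6) measurable_modulated_score[OF assms(4,5), of \<beta>]] by simp

end
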